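(* There is a positive constant $C$ such that for every $f\in C_B[0,\infty)$, every $\beta$ with $0<\beta<1$, every positive integer $n$ and every $x\in[0,\infty)$, $$|D_n^{\beta}(f,x)-f(x)|\le C\,\omega_2\left(f,\sqrt{\frac{2x}{n(1-\beta)}+\frac{2}{n^2(1-\beta)}+\frac{1}{n^2(1-\beta)^2}}\right)+\omega\left(f,\frac{1}{n(1-\beta)}\right).$$
   Context: For $0\le\beta<1$, a positive integer $n$, an integer $k\ge 0$ and $x\in[0,\infty)$, the basis function is $$L_{n,k}^{(\beta)}(x)=\frac{nx(nx+k\beta)^{k-1}}{k!}e^{-(nx+k\beta)}$$ (for $k=0$ this is $e^{-nx}$). The operators $D_n^{\beta}$ are $$D_n^{\beta}(f,x)=\sum_{k=0}^{\infty}\left(\int_0^\infty L_{n,k}^{(\beta)}(t)\,dt\right)^{-1}L_{n,k}^{(\beta)}(x)\int_0^\infty L_{n,k}^{(\beta)}(t)f(t)\,dt .$$ $C_B[0,\infty)$ is the class of real-valued continuous bounded functions on $[0,\infty)$. For $f\in C_B[0,\infty)$ and $\delta>0$ the $m$-th order modulus of continuity is $$\omega_m(f,\delta)=\sup_{0\le h\le\delta}\ \sup_{x\in[0,\infty)}|\Delta_h^m f(x)|,$$ where $\Delta_h$ is the forward difference with step $h$, $\Delta_h f(x)=f(x+h)-f(x)$, and $\Delta_h^m$ is its $m$-th iterate; $\omega=\omega_1$. *)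

theory Defs
  imports "HOL-Analysis.Analysis"
begin

definition C_B :: "(real \<Rightarrow> real) set" where
  "C_B = {f. continuous_on {0..} f \<and> bounded (f ` {0..})}"

(* The case k = 0 is split off because n x (n x)^(-1) has to be read as 1,
   also at x = 0. *)
definition jain_basis :: "nat \<Rightarrow> real \<Rightarrow> nat \<Rightarrow> real \<Rightarrow> real" where
  "jain_basis n \<beta> k x =
     (if k = 0 then exp (- (real n * x))
      else real n * x * (real n * x + real k * \<beta>) ^ (k - 1) / fact k
             * exp (- (real n * x + real k * \<beta>)))"

definition jain_durrmeyer :: "nat \<Rightarrow> real \<Rightarrow> (real \<Rightarrow> real) \<Rightarrow> real \<Rightarrow> real" where
  "jain_durrmeyer n \<beta> f x =
     (\<Sum>k. inverse (LBINT t:{0..}. jain_basis n \<beta> k t) * jain_basis n \<beta> k x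
            * (LBINT t:{0..}. jain_basis n \<beta> k t * f t))"

definition forward_diff :: "real \<Rightarrow> (real \<Rightarrow> real) \<Rightarrow> real \<Rightarrow> real" where
  "forward_diff h f x = f (x + h) - f x"

(* The suprema are real-valued, hence meaningful only when the differences are
   bounded, as they are for f in C_B. *)
definition modulus :: "nat \<Rightarrow> (real \<Rightarrow> real) \<Rightarrow> real \<Rightarrow> real" where
  "modulus m f \<delta> = (SUP h\<in>{0..\<delta>}. SUP x\<in>{0..}. \<bar>(forward_diff h ^^ m) f x\<bar>)"

end

theory Submission
  imports Defs "HOL-Probability.Distributions" "HOL-Computational_Algebra.Polynomial"
begin

text \<open>For \<open>\<delta> > 0\<close> and \<open>y \<ge> 0\<close>, Steklov means give a slope \<open>a\<close> with
  $|f(t) - f(y) - a(t-y)| \le (2 + 9 (t-y)^2/\delta^2)\,\omega_2(f,\delta)$ for all $t \ge 0$.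
  Applying the positive operator $D_n^\beta$ at $x$ and choosing \<open>y\<close> as the image of the identity
  function kills the linear term, so that $|D_n^\beta(f,x) - f(y)| \le (2 + 9\,V/\delta^2)\,\omega_2(f,\delta)$
  with $V$ the variance, and $|f(y) - f(x)|$ is the first-order term. What remains is $V \le 2\delta^2$ and
  $0 \le y - x \le 1/(n(1-\beta))$. The moments of the weights
  $w_k(z) = z(z+k\beta)^{k-1} e^{-(z+k\beta)}/k!$ come from $w_k'(z) = w_{k-1}(z+\beta) - w_k(z)$ by comparing
  partial sums with explicit supersolutions, those of the measures $L_{n,k}^{(\beta)}(t)\,dt$ from
  integration by parts.\<close>

subsection \<open>Moments of the generalized Poisson weights\<close>

text \<open>The basis functions depend on \<open>n\<close> and \<open>x\<close> only through
  \<open>n * x\<close>, so the instance \<open>n = 1\<close> serves all \<open>n\<close>; it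
  inherits the special reading of the term \<open>k = 0\<close>.\<close>

definition gpois :: "real \<Rightarrow> nat \<Rightarrow> real \<Rightarrow> real" where
  "gpois \<beta> k z = jain_basis 1 \<beta> k z"

lemma jain_basis_eq_gpois: "jain_basis n \<beta> k x = gpois \<beta> k (real n * x)"
  by (simp add: gpois_def jain_basis_def)

lemma gpois_0: "gpois \<beta> 0 z = exp (- z)"
  by (simp add: gpois_def jain_basis_def)

lemma gpois_Suc:
  "gpois \<beta> (Suc k) z = z * (z + real (Suc k) * \<beta>) ^ k / fact (Suc k) * exp (- (z + real (Suc k) * \<beta>))"
  by (simp add: gpois_def jain_basis_def)

lemma gpois_nonneg: "0 \<le> \<beta> \<Longrightarrow> 0 \<le> z \<Longrightarrow> 0 \<le> gpois \<beta> k z"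
  by (cases k) (auto simp: gpois_0 gpois_Suc)

lemma gpois_at_0: "gpois \<beta> k 0 = (if k = 0 then 1 else 0)"
  by (cases k) (auto simp: gpois_0 gpois_Suc)

lemma gpois_0_deriv: "(gpois \<beta> 0 has_real_derivative - gpois \<beta> 0 z) (at z)"
  unfolding gpois_0 [abs_def] by (auto intro!: derivative_eq_intros)

text \<open>Up to the exponential factor, \<^const>\<open>gpois\<close> is the Abel polynomial
  $A_k(z) = z (z + k\beta)^{k-1} / k!$, and $A_k'(z) = A_{k-1}(z + \beta)$.\<close>

lemma gpois_Suc_deriv:
  "(gpois \<beta> (Suc k) has_real_derivative gpois \<beta> k (z + \<beta>) - gpois \<beta> (Suc k) z) (at z)"
proof (cases k)
  case 0
  show ?thesis
    unfolding 0 gpois_Suc [abs_def] gpois_0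
    by (auto intro!: derivative_eq_intros simp: algebra_simps minus_diff_commute)
next
  case (Suc j)
  define c where "c = z + real (Suc k) * \<beta>"
  have c: "z + \<beta> + real (Suc j) * \<beta> = c"
    by (simp add: c_def Suc algebra_simps)
  have F: "(fact (Suc k) :: real) = real (Suc k) * fact (Suc j)"
    by (simp add: Suc)
  have "(gpois \<beta> (Suc k) has_real_derivative
      (c ^ k + z * (real k * c ^ j)) / fact (Suc k) * exp (- c) - z * c ^ k / fact (Suc k) * exp (- c)) (at z)"
    unfolding gpois_Suc [abs_def]
    by (rule derivative_eq_intros refl | simp add: c_def[symmetric] Suc)+
       (simp add: field_simps Suc c_def)
  also have "(c ^ k + z * (real k * c ^ j)) / fact (Suc k) * exp (- c) = gpois \<beta> k (z + \<beta>)"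
  proof -
    have "c ^ k + z * (real k * c ^ j) = real (Suc k) * ((z + \<beta>) * c ^ j)"
      by (simp add: Suc c_def algebra_simps)
    then have "(c ^ k + z * (real k * c ^ j)) / fact (Suc k) = (z + \<beta>) * c ^ j / fact (Suc j)"
      unfolding F by (simp add: Suc)
    then show ?thesis
      unfolding Suc gpois_Suc c by simp
  qed
  also have "z * c ^ k / fact (Suc k) * exp (- c) = gpois \<beta> (Suc k) z"
    by (simp add: gpois_Suc c_def)
  finally show ?thesis .
qed

section \<open>Comparison principle and upper bounds for partial sums\<close>

text \<open>Integrating factor: \<open>exp s * (h s - g s)\<close> has derivative
  \<open>exp s\<close> times the difference of the two sides in \<open>le\<close>, so it increases
  from a nonnegative value at 0.\<close>

lemma relaxation_comparison:
  fixes g h g' h' :: "real \<Rightarrow> real"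
  assumes z: "0 \<le> z"
    and g: "\<And>s. (g has_real_derivative g' s) (at s)"
    and h: "\<And>s. (h has_real_derivative h' s) (at s)"
    and le: "\<And>s. 0 \<le> s \<Longrightarrow> s \<le> z \<Longrightarrow> g' s + g s \<le> h' s + h s"
    and le0: "g 0 \<le> h 0"
  shows "g z \<le> h z"
proof -
  have "exp 0 * (h 0 - g 0) \<le> exp z * (h z - g z)"
  proof (rule DERIV_nonneg_imp_nondecreasing [OF z])
    fix s assume s: "0 \<le> s" "s \<le> z"
    have "((\<lambda>s. exp s * (h s - g s)) has_real_derivative
        exp s * ((h' s + h s) - (g' s + g s))) (at s)"
      by (rule derivative_eq_intros g h refl)+ (simp add: algebra_simps)
    moreover have "0 \<le> exp s * ((h' s + h s) - (g' s + g s))"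
      using le [OF s] by simp
    ultimately show "\<exists>y. ((\<lambda>s. exp s * (h s - g s)) has_real_derivative y) (at s) \<and> 0 \<le> y"
      by blast
  qed
  with le0 have "0 \<le> exp z * (h z - g z)" by simp
  then show ?thesis by (simp add: zero_le_mult_iff)
qed

text \<open>The derivative plus the sum itself is a sum at the shifted argument
  \<open>z + \<beta>\<close> with one term fewer. This drop in the number of terms is what makes
  inductions on \<open>N\<close> work.\<close>

lemma weighted_gpois_deriv:
  "((\<lambda>z. \<Sum>k\<le>N. c k * gpois \<beta> k z) has_real_derivative
     ((\<Sum>k<N. c (Suc k) * gpois \<beta> k (z + \<beta>)) - (\<Sum>k\<le>N. c k * gpois \<beta> k z))) (at z)"
proof (induction N)
  case 0
  show ?case using DERIV_cmult [OF gpois_0_deriv, of "c 0" \<beta> z] by simp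
next
  case (Suc N)
  show ?case
    using DERIV_add [OF Suc DERIV_cmult [OF gpois_Suc_deriv, of "c (Suc N)" \<beta> N z]]
    by (simp add: algebra_simps)
qed

text \<open>The hypothesis \<open>step\<close> says that \<open>U\<close> is a supersolution of the equation satisfied by
  the full series for the weights \<open>c\<close>.\<close>

lemma weighted_gpois_le:
  assumes z: "0 \<le> z" and \<beta>: "0 \<le> \<beta>" and U: "\<And>s. (U has_real_derivative U' s) (at s)"
    and init: "c 0 \<le> U 0"
    and step: "\<And>s n. 0 \<le> s \<Longrightarrow>
      (\<And>u. 0 \<le> u \<Longrightarrow> (\<Sum>k<n. c k * gpois \<beta> k u) \<le> U u) \<Longrightarrow>
      (\<Sum>k<n. c (Suc k) * gpois \<beta> k (s + \<beta>)) \<le> U' s + U s"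
    and nonneg: "\<And>u. 0 \<le> u \<Longrightarrow> 0 \<le> U u"
  shows "(\<Sum>k<n. c k * gpois \<beta> k z) \<le> U z"
  using z
proof (induction n arbitrary: z)
  case 0
  then show ?case using nonneg by simp
next
  case (Suc n)
  have at0: "(\<Sum>k\<le>n. c k * gpois \<beta> k 0) = c 0"
    by (simp add: gpois_at_0 if_distrib cong: if_cong)
  have "(\<Sum>k\<le>n. c k * gpois \<beta> k z) \<le> U z"
  proof (rule relaxation_comparison [OF \<open>0 \<le> z\<close> weighted_gpois_deriv U])
    fix s assume "0 \<le> s" "s \<le> z"
    then show "(\<Sum>k<n. c (Suc k) * gpois \<beta> k (s + \<beta>)) - (\<Sum>k\<le>n. c k * gpois \<beta> k s)
        + (\<Sum>k\<le>n. c k * gpois \<beta> k s) \<le> U' s + U s"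
      using step [of s n] Suc.IH by simp
  qed (simp add: at0 init)
  then show ?case by (simp add: lessThan_Suc_atMost)
qed

lemma gpois_sum_le_1:
  assumes "0 \<le> \<beta>" "0 \<le> z"
  shows "(\<Sum>k<n. gpois \<beta> k z) \<le> 1"
  using weighted_gpois_le [of z \<beta> "\<lambda>_. 1" "\<lambda>_. 0" "\<lambda>_. 1" n] assms by simp

text \<open>The bound is the linear function \<open>U\<close> with \<open>U 0 = 0\<close> that
  solves \<open>U' s + U s = U (s + \<beta>) + 1\<close> exactly: its slope \<open>q\<close> must
  satisfy \<open>q = q * \<beta> + 1\<close>.\<close>

lemma gpois_first_moment_le:
  assumes \<beta>: "0 \<le> \<beta>" "\<beta> < 1" and z: "0 \<le> z"
  shows "(\<Sum>k<n. real k * gpois \<beta> k z) \<le> z / (1 - \<beta>)"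
proof (rule weighted_gpois_le [where U' = "\<lambda>_. 1 / (1 - \<beta>)"])
  fix s :: real and n assume s: "0 \<le> s"
    and IH: "\<And>u. 0 \<le> u \<Longrightarrow> (\<Sum>k<n. real k * gpois \<beta> k u) \<le> u / (1 - \<beta>)"
  have "(\<Sum>k<n. real (Suc k) * gpois \<beta> k (s + \<beta>))
      = (\<Sum>k<n. real k * gpois \<beta> k (s + \<beta>)) + (\<Sum>k<n. gpois \<beta> k (s + \<beta>))"
    by (simp add: algebra_simps sum.distrib)
  also have "\<dots> \<le> (s + \<beta>) / (1 - \<beta>) + 1"
    using IH [of "s + \<beta>"] gpois_sum_le_1 [of \<beta> "s + \<beta>" n] s \<beta> by linarith
  also have "\<dots> = 1 / (1 - \<beta>) + s / (1 - \<beta>)"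
    using \<beta> by (simp add: field_simps)
  finally show "(\<Sum>k<n. real (Suc k) * gpois \<beta> k (s + \<beta>)) \<le> 1 / (1 - \<beta>) + s / (1 - \<beta>)" .
qed (use \<beta> z in \<open>auto intro!: derivative_eq_intros\<close>)

text \<open>Expanding \<open>(k + 1)^2\<close> brings in the two lower moments; the bound is the
  quadratic solution, vanishing at 0, of \<open>U' s + U s = U (s + \<beta>) + 2 * (s + \<beta>) /
  (1 - \<beta>) + 1\<close>.\<close>

lemma gpois_second_moment_le:
  assumes \<beta>: "0 \<le> \<beta>" "\<beta> < 1" and z: "0 \<le> z"
  shows "(\<Sum>k<n. (real k)\<^sup>2 * gpois \<beta> k z) \<le> z\<^sup>2 / (1 - \<beta>)\<^sup>2 + z / (1 - \<beta>) ^ 3"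
proof (rule weighted_gpois_le [where U' = "\<lambda>s. 2 * s / (1 - \<beta>)\<^sup>2 + 1 / (1 - \<beta>) ^ 3"])
  define b where "b = 1 - \<beta>"
  have b: "b > 0" "\<beta> = 1 - b" using \<beta> by (auto simp: b_def)
  fix s :: real and n assume s: "0 \<le> s"
    and IH: "\<And>u. 0 \<le> u \<Longrightarrow>
      (\<Sum>k<n. (real k)\<^sup>2 * gpois \<beta> k u) \<le> u\<^sup>2 / (1 - \<beta>)\<^sup>2 + u / (1 - \<beta>) ^ 3"
  have "(\<Sum>k<n. (real (Suc k))\<^sup>2 * gpois \<beta> k (s + \<beta>))
      = (\<Sum>k<n. (real k)\<^sup>2 * gpois \<beta> k (s + \<beta>)) + 2 * (\<Sum>k<n. real k * gpois \<beta> k (s + \<beta>))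
        + (\<Sum>k<n. gpois \<beta> k (s + \<beta>))"
    by (simp add: algebra_simps power2_eq_square sum.distrib sum_distrib_left)
  also have "\<dots> \<le> ((s + \<beta>)\<^sup>2 / (1 - \<beta>)\<^sup>2 + (s + \<beta>) / (1 - \<beta>) ^ 3)
      + 2 * ((s + \<beta>) / (1 - \<beta>)) + 1"
    using IH [of "s + \<beta>"] gpois_sum_le_1 [of \<beta> "s + \<beta>" n]
      gpois_first_moment_le [of \<beta> "s + \<beta>" n] s \<beta> by linarith
  also have "\<dots> = (2 * s / (1 - \<beta>)\<^sup>2 + 1 / (1 - \<beta>) ^ 3) + (s\<^sup>2 / (1 - \<beta>)\<^sup>2 + s / (1 - \<beta>) ^ 3)"
    using b(1) unfolding b_def[symmetric] b(2)
    by (simp add: field_simps power2_eq_square power3_eq_cube)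
  finally show "(\<Sum>k<n. (real (Suc k))\<^sup>2 * gpois \<beta> k (s + \<beta>))
    \<le> (2 * s / (1 - \<beta>)\<^sup>2 + 1 / (1 - \<beta>) ^ 3) + (s\<^sup>2 / (1 - \<beta>)\<^sup>2 + s / (1 - \<beta>) ^ 3)" .
qed (use \<beta> z in \<open>auto intro!: derivative_eq_intros simp: field_simps\<close>)

text \<open>With $K = 4/(1-\beta)$: the bound is trivial for $K z \ge N+1$, and it is a supersolution on the
  remaining interval, except for small \<open>N\<close>, where $1 - e^{-z} \le z$ suffices.\<close>

lemma gpois_tail_le:
  assumes \<beta>: "0 \<le> \<beta>" "\<beta> < 1" and z: "0 \<le> z"
  shows "1 - (\<Sum>k\<le>N. gpois \<beta> k z) \<le> 4 / (1 - \<beta>) * z / real (Suc N)"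
  using z
proof (induction N arbitrary: z)
  case 0
  have "1 - z \<le> exp (- z)" using exp_ge_add_one_self [of "- z"] by simp
  moreover have "1 * z \<le> 4 / (1 - \<beta>) * z"
    using 0 \<beta> by (intro mult_right_mono) (auto simp: field_simps)
  ultimately show ?case by (simp add: gpois_0)
next
  case (Suc N)
  define b where "b = 1 - \<beta>"
  have b: "b > 0" "b \<le> 1" "\<beta> = 1 - b" using \<beta> by (auto simp: b_def)
  define M :: real where "M = real (Suc N)"
  have M: "M \<ge> 1" by (simp add: M_def)
  consider "4 / b * z \<ge> M + 1" | "4 / b * z < M + 1" "4 / b \<ge> M + 1" | "4 / b * z < M + 1" "4 / b < M + 1"
    by linarith
  then have "1 - (\<Sum>k\<le>Suc N. gpois \<beta> k z) \<le> 4 / b * z / (M + 1)"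
  proof cases
    case 1
    have "0 \<le> (\<Sum>k\<le>Suc N. gpois \<beta> k z)"
      using Suc.prems \<beta> by (intro sum_nonneg gpois_nonneg) auto
    moreover have "1 \<le> 4 / b * z / (M + 1)" using 1 M by (subst le_divide_eq_1_pos) auto
    ultimately show ?thesis by linarith
  next
    case 2
    have "exp (- z) \<le> (\<Sum>k\<le>Suc N. gpois \<beta> k z)"
      unfolding sum.atMost_Suc_shift gpois_0
      using Suc.prems \<beta> by (simp add: sum_nonneg gpois_nonneg)
    moreover have "1 - z \<le> exp (- z)" using exp_ge_add_one_self [of "- z"] by simp
    moreover have "1 \<le> 4 / b / (M + 1)"
      using 2 M by (subst le_divide_eq_1_pos) auto
    then have "1 * z \<le> 4 / b / (M + 1) * z"
      using Suc.prems by (intro mult_right_mono) auto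
    ultimately show ?thesis by simp
  next
    case 3
    let ?S = "\<lambda>z. \<Sum>k\<le>Suc N. 1 * gpois \<beta> k z"
    have "1 - 4 / b * z / (M + 1) \<le> ?S z"
    proof (rule relaxation_comparison [OF \<open>0 \<le> z\<close> _ weighted_gpois_deriv])
      show "((\<lambda>z. 1 - 4 / b * z / (M + 1)) has_real_derivative - (4 / b / (M + 1))) (at s)" for s
      proof -
        have "((\<lambda>z. 1 - 4 / b * z / (M + 1)) has_real_derivative 0 - 4 / b * 1 / (M + 1)) (at s)"
          by (intro DERIV_diff DERIV_const DERIV_cdivide DERIV_cmult DERIV_ident)
        then show ?thesis by simp
      qed
      fix s assume s: "0 \<le> s" "s \<le> z"
      have "4 * s \<le> b * (M + 1)"
      proof -
        have "4 * s \<le> 4 * z" using s by simp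
        also have "\<dots> \<le> b * (M + 1)" using 3 b by (simp add: field_simps)
        finally show ?thesis .
      qed
      moreover have "4 \<le> b * (M + 1)" using 3 b by (simp add: field_simps)
      moreover have "b * 2 \<le> b * (M + 1)" using b M by (intro mult_left_mono) auto
      \<comment> \<open>Both \<open>s\<close> and 1 are at most a quarter of
        \<open>b * (M + 1)\<close>, so \<open>s + 1 \<le> b * (M + 1)\<close>, which is this claim.
        It is equivalent to \<open>(s + \<beta>) / M \<le> (s + 1) / (M + 1)\<close>, the inequality
        that makes the linear lower bound a subsolution.\<close>
      ultimately have "s + \<beta> \<le> b * M" unfolding b(3) by (simp add: algebra_simps)
      then have "(s + \<beta>) * (M + 1) \<le> (s + 1) * M"
        unfolding b(3) by (simp add: algebra_simps)
      then have "(s + \<beta>) / M \<le> (s + 1) / (M + 1)"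
        using M by (simp add: field_simps)
      then have "4 / b * ((s + \<beta>) / M) \<le> 4 / b * ((s + 1) / (M + 1))"
        using b(1) by (intro mult_left_mono) auto
      then have le: "4 / b * (s + \<beta>) / M \<le> 4 / b * (s + 1) / (M + 1)"
        by simp
      have "1 - 4 / b * (s + \<beta>) / M \<le> (\<Sum>k<Suc N. gpois \<beta> k (s + \<beta>))"
        using Suc.IH [of "s + \<beta>"] s \<beta> unfolding b_def M_def lessThan_Suc_atMost by simp
      moreover have "4 / b * (s + 1) / (M + 1) = 4 / b * s / (M + 1) + 4 / b / (M + 1)"
        by (simp only: distrib_left add_divide_distrib mult_1_right)
      ultimately show "- (4 / b / (M + 1)) + (1 - 4 / b * s / (M + 1))
          \<le> (\<Sum>k<Suc N. 1 * gpois \<beta> k (s + \<beta>)) - ?S s + ?S s"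
        using le by (simp del: times_divide_eq_left times_divide_eq_right divide_divide_eq_left)
    qed (simp add: gpois_at_0)
    then show ?thesis by simp
  qed
  then show ?case by (simp add: b_def M_def add.commute)
qed

section \<open>Total mass and exact mean of the weights\<close>

text \<open>The partial sums are squeezed between \<open>1 - O(1/N)\<close>, from the tail bound,
  and 1.\<close>

lemma gpois_sums_1:
  assumes \<beta>: "0 \<le> \<beta>" "\<beta> < 1" and z: "0 \<le> z"
  shows "(\<lambda>k. gpois \<beta> k z) sums 1"
  unfolding sums_def_le
proof (rule tendsto_sandwich [of "\<lambda>N. 1 - 4 / (1 - \<beta>) * z / real (Suc N)" _ _ "\<lambda>_. 1"])
  show "(\<lambda>N. 1 - 4 / (1 - \<beta>) * z / real (Suc N)) \<longlonglongrightarrow> 1"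
    by (rule tendsto_eq_intros LIMSEQ_Suc [OF lim_const_over_n] refl)+ simp
  have "1 - 4 / (1 - \<beta>) * z / real (Suc N) \<le> (\<Sum>k\<le>N. gpois \<beta> k z)" for N
    using gpois_tail_le [OF assms, of N] by simp
  then show "\<forall>\<^sub>F N in sequentially. 1 - 4 / (1 - \<beta>) * z / real (Suc N) \<le> (\<Sum>k\<le>N. gpois \<beta> k z)"
    by simp
  have "(\<Sum>k\<le>N. gpois \<beta> k z) \<le> 1" for N
    using gpois_sum_le_1 [of \<beta> z "Suc N"] assms by (simp add: lessThan_Suc_atMost)
  then show "\<forall>\<^sub>F N in sequentially. (\<Sum>k\<le>N. gpois \<beta> k z) \<le> 1"
    by simp
qed simp_all

lemma summable_gpois_first_moment:
  assumes \<beta>: "0 \<le> \<beta>" "\<beta> < 1" and z: "0 \<le> z"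
  shows "summable (\<lambda>k. real k * gpois \<beta> k z)"
    using gpois_first_moment_le [OF assms] gpois_nonneg [OF \<beta>(1) z]
    by (intro summableI_nonneg_bounded) auto

lemma summable_gpois_second_moment:
  assumes \<beta>: "0 \<le> \<beta>" "\<beta> < 1" and z: "0 \<le> z"
  shows "summable (\<lambda>k. (real k)\<^sup>2 * gpois \<beta> k z)"
    using gpois_second_moment_le [OF assms] gpois_nonneg [OF \<beta>(1) z]
    by (intro summableI_nonneg_bounded) auto

text \<open>The factor \<open>k + 1\<close> cancels against the factorial, which turns the weight of
  index \<open>k + 1\<close> at \<open>z\<close> into a multiple of the weight of index
  \<open>k\<close> at \<open>z + \<beta>\<close>; the total mass at \<open>z + \<beta>\<close> then
  contributes the summand 1.\<close>

lemma gpois_first_moment_rec: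
  assumes \<beta>: "0 \<le> \<beta>" "\<beta> < 1" and z: "0 < z"
  shows "(\<Sum>k. real k * gpois \<beta> k z) / z = 1 + \<beta> * ((\<Sum>k. real k * gpois \<beta> k (z + \<beta>)) / (z + \<beta>))"
proof -
  have z\<beta>: "0 < z + \<beta>" using \<beta> z by simp
  have eq: "real (Suc k) * gpois \<beta> (Suc k) z
      = z * gpois \<beta> k (z + \<beta>) + z * \<beta> / (z + \<beta>) * (real k * gpois \<beta> k (z + \<beta>))" for k
  proof (cases k)
    case 0
    then show ?thesis by (simp add: gpois_0 gpois_Suc)
  next
    case (Suc j)
    define c where "c = z + real (Suc k) * \<beta>"
    have c: "z + \<beta> + real (Suc j) * \<beta> = c" "z + \<beta> + real k * \<beta> = c"
      by (auto simp: c_def Suc algebra_simps)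
    have "real (Suc k) * gpois \<beta> (Suc k) z = z * c ^ Suc j / fact k * exp (- c)"
      unfolding gpois_Suc c_def[symmetric] by (simp add: Suc del: power_Suc)
    also have "\<dots> = z * c / (z + \<beta>) * ((z + \<beta>) * c ^ j / fact k * exp (- c))"
      using z\<beta> by simp
    also have "\<dots> = z * c / (z + \<beta>) * gpois \<beta> k (z + \<beta>)"
      unfolding Suc gpois_Suc c ..
    \<comment> \<open>Here \<open>c\<close> is split as \<open>(z + \<beta>) + k * \<beta>\<close>:
      the first part gives a plain weight, the second a term of the first moment.\<close>
    also have "\<dots> = z * gpois \<beta> k (z + \<beta>) + z * \<beta> / (z + \<beta>) * (real k * gpois \<beta> k (z + \<beta>))"
      unfolding c(2)[symmetric] using z\<beta> by (simp add: field_simps)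
    finally show ?thesis .
  qed
  have "(\<lambda>k. z * gpois \<beta> k (z + \<beta>) + z * \<beta> / (z + \<beta>) * (real k * gpois \<beta> k (z + \<beta>)))
      sums (z * 1 + z * \<beta> / (z + \<beta>) * (\<Sum>k. real k * gpois \<beta> k (z + \<beta>)))"
    using \<beta> z\<beta>
    by (intro sums_add sums_mult gpois_sums_1 summable_sums summable_gpois_first_moment) auto
  then have "(\<lambda>k. real (Suc k) * gpois \<beta> (Suc k) z)
      sums (z * 1 + z * \<beta> / (z + \<beta>) * (\<Sum>k. real k * gpois \<beta> k (z + \<beta>)))"
    by (simp only: eq)
  then have "(\<Sum>k. real k * gpois \<beta> k z)
      = z * 1 + z * \<beta> / (z + \<beta>) * (\<Sum>k. real k * gpois \<beta> k (z + \<beta>))"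
    using sums_Suc [of "\<lambda>k. real k * gpois \<beta> k z"] by (simp add: sums_iff)
  then show ?thesis using z z\<beta> by (simp add: field_simps)
qed

text \<open>The recursion has fixed point \<open>1 / (1 - \<beta>)\<close>. The defect
  \<open>e\<close> from it satisfies \<open>e u = \<beta> * e (u + \<beta>)\<close> and stays in a
  bounded interval, so iterating forces it to 0. Equality is needed because the mean of the operator
  is bounded from both sides.\<close>

lemma gpois_first_moment:
  assumes \<beta>: "0 \<le> \<beta>" "\<beta> < 1" and z: "0 \<le> z"
  shows "(\<lambda>k. real k * gpois \<beta> k z) sums (z / (1 - \<beta>))"
proof (cases "z = 0")
  case True
  then have "(\<lambda>k. real k * gpois \<beta> k z) = (\<lambda>_. 0)"
    by (auto simp: gpois_at_0)
  then show ?thesis using True by simp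
next
  case False
  define e where "e u = 1 / (1 - \<beta>) - (\<Sum>k. real k * gpois \<beta> k u) / u" for u
  have e_rec: "e u = \<beta> * e (u + \<beta>)" if "u > 0" for u
    unfolding e_def gpois_first_moment_rec [OF \<beta> that]
    using \<beta> by (simp add: field_simps)
  have e_bounds: "0 \<le> e u" "e u \<le> 1 / (1 - \<beta>)" if "u > 0" for u
  proof -
    have "(\<Sum>k. real k * gpois \<beta> k u) \<le> u / (1 - \<beta>)"
      using \<beta> that by (intro suminf_le_const summable_gpois_first_moment gpois_first_moment_le) auto
    then show "0 \<le> e u" unfolding e_def using that \<beta> by (simp add: field_simps)
    have "0 \<le> (\<Sum>k. real k * gpois \<beta> k u)"
      using \<beta> that by (intro suminf_nonneg summable_gpois_first_moment) (auto simp: gpois_nonneg)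
    then show "e u \<le> 1 / (1 - \<beta>)" unfolding e_def using that by simp
  qed
  have iter: "e u \<le> \<beta> ^ i * (1 / (1 - \<beta>))" if "u > 0" for u i
    using that
  proof (induction i arbitrary: u)
    case 0
    then show ?case using e_bounds by simp
  next
    case (Suc i)
    have "\<beta> * e (u + \<beta>) \<le> \<beta> * (\<beta> ^ i * (1 / (1 - \<beta>)))"
      using Suc \<beta> by (intro mult_left_mono) auto
    then show ?case using e_rec Suc.prems by simp
  qed
  have "(\<lambda>i. \<beta> ^ i * (1 / (1 - \<beta>))) \<longlonglongrightarrow> 0 * (1 / (1 - \<beta>))"
    using \<beta> by (intro tendsto_intros LIMSEQ_realpow_zero) auto
  then have "e z \<le> 0"
    using iter False z by (intro LIMSEQ_le_const [of _ 0]) auto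
  then have "(\<Sum>k. real k * gpois \<beta> k z) = z / (1 - \<beta>)"
    using e_bounds [of z] False z by (simp add: e_def field_simps)
  then show ?thesis
    using summable_sums [OF summable_gpois_first_moment [OF assms]] by simp
qed

lemma gpois_second_moment:
  assumes \<beta>: "0 \<le> \<beta>" "\<beta> < 1" and z: "0 \<le> z"
  shows "(\<Sum>k. (real k)\<^sup>2 * gpois \<beta> k z) \<le> z\<^sup>2 / (1 - \<beta>)\<^sup>2 + z / (1 - \<beta>) ^ 3"
  using assms by (intro suminf_le_const summable_gpois_second_moment gpois_second_moment_le)

subsection \<open>Moments of the basis functions\<close>

text \<open>The Laplace transform at \<open>l\<close> as a functional on polynomials, so that
  integration by parts turns polynomial identities into moment relations.\<close>

definition exp_integral :: "real \<Rightarrow> real poly \<Rightarrow> real" where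
  "exp_integral l p = (LBINT t:{0..}. poly p t * exp (- (l * t)))"

text \<open>Up to a constant factor the integrand is the Erlang density, whose moment of order 0 is
  finite.\<close>

lemma set_integrable_power_exp:
  assumes "0 < (l::real)"
  shows "set_integrable lborel {0..} (\<lambda>t. t ^ i * exp (- (l * t)))"
proof -
  have "integrable lborel (\<lambda>t. erlang_density i l t * t ^ 0)"
  proof (rule integrableI_nonneg)
    show "(\<integral>\<^sup>+ t. ennreal (erlang_density i l t * t ^ 0) \<partial>lborel) < \<infinity>"
      unfolding nn_integral_erlang_ith_moment [OF assms] by simp
  qed (use assms in auto)
  then have "integrable lborel (\<lambda>t. fact i / l ^ Suc i * erlang_density i l t)"
    by simp
  moreover have "(\<lambda>t. fact i / l ^ Suc i * erlang_density i l t)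
      = (\<lambda>t. indicator {0..} t *\<^sub>R (t ^ i * exp (- (l * t))))"
    using assms by (auto simp: erlang_density_def fun_eq_iff indicator_def)
  ultimately show ?thesis
    unfolding set_integrable_def by simp
qed

lemma set_integrable_poly_exp:
  assumes "0 < (l::real)"
  shows "set_integrable lborel {0..} (\<lambda>t. poly p t * exp (- (l * t)))"
proof -
  have "integrable lborel (\<lambda>t. \<Sum>i\<le>degree p.
      coeff p i * (indicator {0..} t *\<^sub>R (t ^ i * exp (- (l * t)))))"
    by (intro Bochner_Integration.integrable_sum integrable_mult_right
        set_integrable_power_exp [OF assms, unfolded set_integrable_def])
  then show ?thesis
    by (simp add: set_integrable_def poly_altdef sum_distrib_right sum_distrib_left mult_ac)
qed

lemma tendsto_poly_exp_0:
  assumes "0 < (l::real)"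
  shows "((\<lambda>t. poly p t * exp (- (l * t))) \<longlongrightarrow> 0) at_top"
proof -
  have "((\<lambda>t. (l * t) ^ i / exp (l * t)) \<longlongrightarrow> 0) at_top" for i
    by (rule filterlim_compose [OF tendsto_power_div_exp_0])
       (use assms in \<open>auto intro: filterlim_tendsto_pos_mult_at_top filterlim_ident\<close>)
  then have "((\<lambda>t. \<Sum>i\<le>degree p. coeff p i / l ^ i * ((l * t) ^ i / exp (l * t)))
      \<longlongrightarrow> (\<Sum>i\<le>degree p. coeff p i / l ^ i * 0)) at_top"
    by (intro tendsto_intros)
  moreover have "(\<Sum>i\<le>degree p. coeff p i / l ^ i * ((l * t) ^ i / exp (l * t)))
      = poly p t * exp (- (l * t))" for t
    unfolding poly_altdef sum_distrib_right
    by (intro sum.cong) (use assms in \<open>auto simp: power_mult_distrib exp_minus field_simps\<close>)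
  ultimately show ?thesis by simp
qed

text \<open>The function \<open>- p t * exp (- l t)\<close> is an antiderivative of the integrand
  and vanishes at infinity, so only the boundary term at 0 remains.\<close>

lemma exp_integral_by_parts:
  assumes l: "0 < l"
  shows "exp_integral l (smult l p - pderiv p) = poly p 0"
proof -
  let ?f = "\<lambda>t. poly (smult l p - pderiv p) t * exp (- (l * t))"
  let ?F = "\<lambda>t. - (poly p t * exp (- (l * t)))"
  have deriv: "(?F has_real_derivative ?f t) (at t)" for t
    by (auto intro!: derivative_eq_intros simp: algebra_simps)
  have "((\<lambda>T. LBINT t:{0..T}. ?f t) \<longlongrightarrow> (LBINT t:{0..}. ?f t)) at_top"
    by (rule tendsto_set_lebesgue_integral_at_top [OF _ set_integrable_poly_exp [OF l]]) auto
  moreover have "((\<lambda>T. LBINT t:{0..T}. ?f t) \<longlongrightarrow> - 0 - ?F 0 * 1) at_top"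
  proof (rule Lim_transform_eventually)
    show "((\<lambda>T. ?F T - ?F 0 * 1) \<longlongrightarrow> - 0 - ?F 0 * 1) at_top"
      by (intro tendsto_diff tendsto_minus tendsto_poly_exp_0 l tendsto_const)
    show "\<forall>\<^sub>F T in at_top. ?F T - ?F 0 * 1 = (LBINT t:{0..T}. ?f t)"
      using eventually_ge_at_top [of 0]
    proof eventually_elim
      fix T :: real assume "0 \<le> T"
      then have "(LBINT t:{0..T}. ?f t) = ?F T - ?F 0"
        unfolding set_lebesgue_integral_def
        by (intro integral_FTC_atLeastAtMost has_real_derivative_iff_has_vector_derivative [THEN iffD1]
            has_field_derivative_at_within [OF deriv] continuous_intros)
      then show "?F T - ?F 0 * 1 = (LBINT t:{0..T}. ?f t)" by simp
    qed
  qed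
  ultimately have "(LBINT t:{0..}. ?f t) = - 0 - ?F 0 * 1"
    by (rule tendsto_unique [rotated]) simp
  then show ?thesis by (simp add: exp_integral_def)
qed

lemma exp_integral_add: "0 < l \<Longrightarrow> exp_integral l (p + q) = exp_integral l p + exp_integral l q"
  unfolding exp_integral_def
  by (simp add: distrib_right set_integral_add set_integrable_poly_exp)

lemma exp_integral_smult: "exp_integral l (smult c p) = c * exp_integral l p"
  unfolding exp_integral_def by (simp add: mult.assoc)

lemma exp_integral_diff: "0 < l \<Longrightarrow> exp_integral l (p - q) = exp_integral l p - exp_integral l q"
  using exp_integral_add [of l p "smult (-1) q"] exp_integral_smult [of l "-1" q] by simp

lemma exp_integral_nonneg: "(\<And>t. 0 \<le> t \<Longrightarrow> 0 \<le> poly p t) \<Longrightarrow> 0 \<le> exp_integral l p"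
  unfolding exp_integral_def set_lebesgue_integral_def
  by (intro integral_nonneg_AE AE_I2) (auto simp: indicator_def)


section \<open>Moments of the individual measures\<close>

text \<open>With \<open>A = [:k * \<beta>, l:]\<close>, integration by parts applied to
  \<open>A^k\<close>, \<open>X * A^k\<close> and \<open>X^2 * A^k\<close> gives three linear
  relations between the moments of \<open>W = X * A^j\<close> and the auxiliary integral of
  \<open>A^j\<close>.\<close>

lemma abel_weight_moments:
  assumes l: "0 < l" and \<beta>: "0 < \<beta>" "\<beta> < 1" and k: "k = Suc j"
  defines "W \<equiv> [:0, 1:] * [:real k * \<beta>, l:] ^ j"
  shows "0 < exp_integral l W"
    and "(real k * (1 - \<beta>) + 1) * exp_integral l W \<le> l * exp_integral l (W * [:0, 1:])"
    and "l * exp_integral l (W * [:0, 1:]) \<le> (real k * (1 - \<beta>) + 1 / (1 - \<beta>)) * exp_integral l W"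
    and "l\<^sup>2 * exp_integral l (W * [:0, 1:]\<^sup>2)
      \<le> ((real k)\<^sup>2 * (1 - \<beta>)\<^sup>2 + 3 * real k + 2 / (1 - \<beta>)) * exp_integral l W"
proof -
  define a where "a = real k * \<beta>"
  define b where "b = 1 - \<beta>"
  have b: "0 < b" "\<beta> = 1 - b" "a = real k - real k * b"
    using \<beta> by (auto simp: b_def a_def algebra_simps)
  have a: "0 < a" using \<beta> k by (simp add: a_def)
  have k0: "0 < real k" using k by simp
  let ?X = "[:0, 1:] :: real poly"
  let ?A = "[:a, l:]"
  let ?G = "exp_integral l (?A ^ j)"
  let ?W0 = "exp_integral l W" and ?W1 = "exp_integral l (W * ?X)" and ?W2 = "exp_integral l (W * ?X\<^sup>2)"
  have W: "W = ?X * ?A ^ j" by (simp add: W_def a_def)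
  have nonneg: "0 \<le> ?G" "0 \<le> ?W0"
    using a l unfolding W by (auto intro!: exp_integral_nonneg)
  note lin = exp_integral_add [OF l] exp_integral_smult
  have deriv: "pderiv (?A ^ k) = smult (real k * l) (?A ^ j)"
    by (simp add: k pderiv_power_Suc pderiv_pCons mult.commute del: power_Suc)
  have "smult l (?A ^ k) - pderiv (?A ^ k) = smult (l * l) W + smult (l * (a - real k)) (?A ^ j)"
    unfolding deriv by (rule poly_ext) (simp add: W k algebra_simps)
  then have "l * l * ?W0 + l * (a - real k) * ?G = a ^ k"
    using exp_integral_by_parts [OF l, of "?A ^ k"] by (simp add: lin)
  then have G: "l * (l * ?W0 - real k * b * ?G) = a ^ k"
    unfolding b(3) by (simp add: algebra_simps)
  moreover have "0 < a ^ k" using a by simp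
  \<comment> \<open>The boundary term \<open>a ^ k\<close> is positive; dropping it bounds the
    auxiliary integral \<open>?G\<close> by the mass \<open>?W0\<close>.\<close>
  ultimately have G': "real k * b * ?G < l * ?W0"
    using l by (metis diff_gt_0_iff_gt zero_less_mult_pos)
  then show pos: "0 < ?W0"
    using nonneg(1) l b k0 by (smt (verit) mult_nonneg_nonneg zero_less_mult_pos)
  have "smult l (?X * ?A ^ k) - pderiv (?X * ?A ^ k)
      = smult l (smult l (W * ?X) + smult (a - real k - 1) W) + smult (- a) (?A ^ j)"
    unfolding pderiv_mult deriv by (rule poly_ext) (simp add: W k pderiv_pCons algebra_simps)
  then have "l * (l * ?W1 + (a - real k - 1) * ?W0) + (- a) * ?G = 0"
    using exp_integral_by_parts [OF l, of "?X * ?A ^ k"] by (simp only: lin) simp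
  then have W1: "l * ?W1 = (real k * b + 1) * ?W0 + a * ?G / l"
    using l unfolding b(3) by (simp add: field_simps)
  then show "(real k * (1 - \<beta>) + 1) * ?W0 \<le> l * ?W1"
    using a nonneg l by (simp add: b_def)
  \<comment> \<open>The lower bound on \<open>?W1\<close> discarded the nonnegative term
    \<open>a * ?G / l\<close>; for the upper bound it is estimated through \<open>G'\<close>, which
    turns the 1 into \<open>1 / b\<close>.\<close>
  have "a * ?G / l \<le> \<beta> / b * ?W0"
    using mult_left_mono [OF less_imp_le [OF G'], of \<beta>] b(1) l \<beta> unfolding a_def
    by (simp add: field_simps)
  also have "\<beta> / b = 1 / b - 1" using b by (simp add: field_simps)
  finally show le1: "l * ?W1 \<le> (real k * (1 - \<beta>) + 1 / (1 - \<beta>)) * ?W0"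
    unfolding W1 b_def[symmetric] by (simp add: algebra_simps)
  have "smult l (?X\<^sup>2 * ?A ^ k) - pderiv (?X\<^sup>2 * ?A ^ k)
      = smult (l * l) (W * ?X\<^sup>2) + smult (l * (a - real k - 2)) (W * ?X) + smult (- 2 * a) W"
    unfolding power2_eq_square pderiv_mult deriv
    by (rule poly_ext) (simp add: W k pderiv_pCons algebra_simps)
  then have "l * l * ?W2 + l * (a - real k - 2) * ?W1 + (- 2 * a) * ?W0 = 0"
    using exp_integral_by_parts [OF l, of "?X\<^sup>2 * ?A ^ k"] by (simp only: lin) simp
  then have "l\<^sup>2 * ?W2 = (real k * b + 2) * (l * ?W1) + 2 * a * ?W0"
    unfolding b(3) by (simp add: algebra_simps power2_eq_square)
  also have "\<dots> \<le> (real k * b + 2) * ((real k * b + 1 / b) * ?W0) + 2 * a * ?W0"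
    using le1 b k0 unfolding b_def[symmetric] by (intro add_right_mono mult_left_mono) auto
  also have "\<dots> = ((real k)\<^sup>2 * b\<^sup>2 + 3 * real k + 2 / b) * ?W0"
    unfolding b(3) using b(1) by (simp add: field_simps power2_eq_square)
  finally show "l\<^sup>2 * ?W2 \<le> ((real k)\<^sup>2 * (1 - \<beta>)\<^sup>2 + 3 * real k + 2 / (1 - \<beta>)) * ?W0"
    by (simp add: b_def)
qed

definition jain_poly :: "nat \<Rightarrow> real \<Rightarrow> nat \<Rightarrow> real poly" where
  "jain_poly n \<beta> k = (if k = 0 then 1 else smult (real n / fact k * exp (- (real k * \<beta>)))
     ([:0, 1:] * [:real k * \<beta>, real n:] ^ (k - 1)))"

lemma jain_basis_eq_poly_exp:
  "jain_basis n \<beta> k t = poly (jain_poly n \<beta> k) t * exp (- (real n * t))"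
  by (auto simp: jain_basis_def jain_poly_def exp_diff exp_minus field_simps)

definition jain_moment :: "nat \<Rightarrow> real \<Rightarrow> nat \<Rightarrow> nat \<Rightarrow> real" where
  "jain_moment n \<beta> k i = (LBINT t:{0..}. jain_basis n \<beta> k t * t ^ i)"

lemma jain_moment_eq_exp_integral:
  "jain_moment n \<beta> k i = exp_integral (real n) (jain_poly n \<beta> k * [:0, 1:] ^ i)"
  unfolding jain_moment_def exp_integral_def jain_basis_eq_poly_exp
  by (simp add: mult_ac)

lemma set_integrable_jain_basis_power:
  assumes "n > 0"
  shows "set_integrable lborel {0..} (\<lambda>t. jain_basis n \<beta> k t * t ^ i)"
  using set_integrable_poly_exp [of "real n" "jain_poly n \<beta> k * [:0, 1:] ^ i"] assms
  unfolding jain_basis_eq_poly_exp by (simp add: mult_ac)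

text \<open>Integration by parts with 1, \<open>X\<close> and \<open>X^2\<close>. These are the
  moments for \<open>k = 0\<close>, where the basis function is a pure exponential without the
  factor \<open>X\<close>.\<close>

lemma exp_integral_exp_moments:
  assumes l: "0 < l"
  shows "l * exp_integral l 1 = 1" "l * exp_integral l [:0, 1:] = exp_integral l 1"
    "l * exp_integral l ([:0, 1:]\<^sup>2) = 2 * exp_integral l [:0, 1:]"
proof -
  note by_parts = exp_integral_by_parts [OF l, unfolded exp_integral_diff [OF l] exp_integral_smult]
  show "l * exp_integral l 1 = 1"
    \<comment> \<open>The instance with factor 0 says that the integral of the zero polynomial, the
      derivative of 1, vanishes.\<close>
    using by_parts [of 1] exp_integral_smult [of l 0 0] by simp
  show "l * exp_integral l [:0, 1:] = exp_integral l 1"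
    using by_parts [of "[:0, 1:]"] by (simp add: pderiv_pCons one_pCons)
  have "pderiv ([:0, 1:]\<^sup>2) = smult 2 [:0, 1 :: real:]"
    by (simp add: power2_eq_square pderiv_mult pderiv_pCons)
  then show "l * exp_integral l ([:0, 1:]\<^sup>2) = 2 * exp_integral l [:0, 1:]"
    using by_parts [of "[:0, 1:]\<^sup>2"] by (simp only: exp_integral_smult) simp
qed

text \<open>For \<open>k > 0\<close> the inequalities are homogeneous in the basis function, so its
  positive constant factor can be multiplied in. For \<open>k = 0\<close> the moments are explicit
  and \<open>1 \<le> 1 / (1 - \<beta>)\<close> suffices.\<close>

lemma jain_moment_bounds:
  assumes n: "n > 0" and \<beta>: "0 < \<beta>" "\<beta> < 1"
  shows "0 < jain_moment n \<beta> k 0"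
    and "(real k * (1 - \<beta>) + 1) * jain_moment n \<beta> k 0 \<le> real n * jain_moment n \<beta> k 1"
    and "real n * jain_moment n \<beta> k 1 \<le> (real k * (1 - \<beta>) + 1 / (1 - \<beta>)) * jain_moment n \<beta> k 0"
    and "(real n)\<^sup>2 * jain_moment n \<beta> k 2
      \<le> ((real k)\<^sup>2 * (1 - \<beta>)\<^sup>2 + 3 * real k + 2 / (1 - \<beta>)) * jain_moment n \<beta> k 0"
proof -
  have "0 < jain_moment n \<beta> k 0
    \<and> (real k * (1 - \<beta>) + 1) * jain_moment n \<beta> k 0 \<le> real n * jain_moment n \<beta> k 1
    \<and> real n * jain_moment n \<beta> k 1 \<le> (real k * (1 - \<beta>) + 1 / (1 - \<beta>)) * jain_moment n \<beta> k 0
    \<and> (real n)\<^sup>2 * jain_moment n \<beta> k 2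
      \<le> ((real k)\<^sup>2 * (1 - \<beta>)\<^sup>2 + 3 * real k + 2 / (1 - \<beta>)) * jain_moment n \<beta> k 0"
  proof (cases k)
    case 0
    let ?M = "jain_moment n \<beta> k"
    have l: "0 < real n" using n by simp
    have "?M 0 = exp_integral (real n) 1" "?M 1 = exp_integral (real n) [:0, 1:]"
      "?M 2 = exp_integral (real n) ([:0, 1:]\<^sup>2)"
      by (simp_all add: jain_moment_eq_exp_integral jain_poly_def 0)
    note M = exp_integral_exp_moments [OF l, folded this]
    have pos: "0 < ?M 0" using M(1) l by (metis zero_less_mult_pos zero_less_one)
    have "(real n)\<^sup>2 * ?M 2 = 2 * ?M 0"
      using M by (simp add: power2_eq_square mult.assoc mult.left_commute)
    moreover have "1 * ?M 0 \<le> 1 / (1 - \<beta>) * ?M 0"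
      using pos \<beta> by (intro mult_right_mono) auto
    ultimately show ?thesis
      using pos M(2) by (simp add: 0)
  next
    case (Suc j)
    let ?M = "jain_moment n \<beta> k"
    have l: "0 < real n" using n by simp
    define c where "c = real n / fact k * exp (- (real k * \<beta>))"
    have c: "0 < c" using n by (simp add: c_def)
    let ?W = "[:0, 1:] * [:real k * \<beta>, real n:] ^ j"
    have "jain_poly n \<beta> k = smult c ?W" by (simp add: jain_poly_def c_def Suc)
    then have M: "?M i = c * exp_integral (real n) (?W * [:0, 1:] ^ i)" for i
      unfolding jain_moment_eq_exp_integral by (simp only: mult_smult_left exp_integral_smult)
    note W = abel_weight_moments [OF l \<beta> Suc]
    show ?thesis
      using W(1) W(2-4) [THEN mult_left_mono, of c] c
      unfolding M power_0 power_one_right mult_1_right by (simp only: mult_ac) simp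
  qed
  then show "0 < jain_moment n \<beta> k 0"
    and "(real k * (1 - \<beta>) + 1) * jain_moment n \<beta> k 0 \<le> real n * jain_moment n \<beta> k 1"
    and "real n * jain_moment n \<beta> k 1 \<le> (real k * (1 - \<beta>) + 1 / (1 - \<beta>)) * jain_moment n \<beta> k 0"
    and "(real n)\<^sup>2 * jain_moment n \<beta> k 2
      \<le> ((real k)\<^sup>2 * (1 - \<beta>)\<^sup>2 + 3 * real k + 2 / (1 - \<beta>)) * jain_moment n \<beta> k 0"
    by blast+
qed

subsection \<open>Second-order modulus and linear approximation\<close>

lemma abs_forward_diff_pow_le:
  assumes "0 \<le> h" "0 \<le> x" and B: "\<And>x. 0 \<le> x \<Longrightarrow> \<bar>f x\<bar> \<le> B"
  shows "\<bar>(forward_diff h ^^ m) f x\<bar> \<le> 2 ^ m * B"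
  using \<open>0 \<le> x\<close>
proof (induction m arbitrary: x)
  case 0
  then show ?case using B by simp
next
  case (Suc m)
  show ?case
    using Suc.IH [of x] Suc.IH [of "x + h"] Suc.prems \<open>0 \<le> h\<close>
    by (simp add: forward_diff_def)
qed

text \<open>A real-valued supremum is an upper bound only over a set bounded above; the bound
  \<open>2 ^ m * B\<close>, uniform in \<open>h\<close> and \<open>x\<close>, provides this for both
  suprema.\<close>

lemma abs_forward_diff_le_modulus:
  assumes f: "f \<in> C_B" and h: "0 \<le> h" "h \<le> \<delta>" and x: "0 \<le> x"
  shows "\<bar>(forward_diff h ^^ m) f x\<bar> \<le> modulus m f \<delta>"
proof -
  from f obtain B where "\<And>x. 0 \<le> x \<Longrightarrow> \<bar>f x\<bar> \<le> B"
    by (auto simp: C_B_def bounded_iff)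
  then have le: "\<bar>(forward_diff h ^^ m) f x\<bar> \<le> 2 ^ m * B" if "0 \<le> h" "0 \<le> x" for h x
    using abs_forward_diff_pow_le that by blast
  have bdd: "bdd_above ((\<lambda>x. \<bar>(forward_diff h ^^ m) f x\<bar>) ` {0..})" if "0 \<le> h" for h
    using le that by (intro bdd_aboveI2) auto
  have "\<bar>(forward_diff h ^^ m) f x\<bar> \<le> (SUP x\<in>{0..}. \<bar>(forward_diff h ^^ m) f x\<bar>)"
    using bdd h x by (intro cSUP_upper) auto
  also have "\<dots> \<le> modulus m f \<delta>"
    unfolding modulus_def
  proof (rule cSUP_upper)
    show "bdd_above ((\<lambda>h. SUP x\<in>{0..}. \<bar>(forward_diff h ^^ m) f x\<bar>) ` {0..\<delta>})"
      using le by (intro bdd_aboveI2 [where M = "2 ^ m * B"] cSUP_least) auto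
  qed (use h in auto)
  finally show ?thesis .
qed

section \<open>Linear approximation through Steklov means\<close>

lemma continuous_imp_has_antiderivative:
  fixes g :: "real \<Rightarrow> real"
  assumes "continuous_on UNIV g"
  obtains G where "\<And>x. (G has_real_derivative g x) (at x)"
  using einterval_antiderivative [of "-\<infinity>" "\<infinity>" g] assms that
  by (auto simp: continuous_on_eq_continuous_at has_real_derivative_iff_has_vector_derivative)

text \<open>The slope at \<open>y\<close> is that of the Steklov mean
  $S(x) = c^{-2} \int_0^c \int_0^c (2 f(x+s+t) - f(x+2(s+t)))\,ds\,dt$ with $c = \delta/2$, here written
  through a second antiderivative \<open>G\<close> of \<open>f\<close>: both $f - S$ and $S''$ are combinations of second
  differences of \<open>f\<close> of step at most $\delta$.\<close>

lemma C_B_linear_approximation: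
  assumes f: "f \<in> C_B" and \<delta>: "0 < \<delta>" and y: "0 \<le> y"
  obtains a where "\<And>t. 0 \<le> t \<Longrightarrow>
    \<bar>f t - f y - a * (t - y)\<bar> \<le> (2 + 9 * (t - y)\<^sup>2 / \<delta>\<^sup>2) * modulus 2 f \<delta>"
proof -
  define \<omega> where "\<omega> = modulus 2 f \<delta>"
  define c where "c = \<delta> / 2"
  have c: "0 < c" using \<delta> by (simp add: c_def)
  \<comment> \<open>Continuous extension to the whole line, so that the antiderivatives are
    differentiable at 0 from both sides.\<close>
  define g where "g x = f (max 0 x)" for x
  have g_eq: "g x = f x" if "0 \<le> x" for x using that by (simp add: g_def)
  have "continuous_on UNIV g"
    unfolding g_def using f
    by (intro continuous_on_compose2 [of "{0..}" f UNIV "max 0"] continuous_intros) (auto simp: C_B_def)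
  then obtain F where F: "\<And>x. (F has_real_derivative g x) (at x)"
    using continuous_imp_has_antiderivative by blast
  then have "continuous_on UNIV F"
    by (auto intro: DERIV_continuous_on)
  then obtain G where G: "\<And>x. (G has_real_derivative F x) (at x)"
    using continuous_imp_has_antiderivative by blast
  note F' = DERIV_chain2 [OF F] and G' = DERIV_chain2 [OF G]
  define D where "D h x = g (x + 2 * h) - 2 * g (x + h) + g x" for h x
  have D: "\<bar>D h x\<bar> \<le> \<omega>" if "0 \<le> h" "h \<le> 2 * c" "0 \<le> x" for h x
    using abs_forward_diff_le_modulus [OF f, of h \<delta> x 2] that
    by (simp add: D_def \<omega>_def c_def g_eq forward_diff_def numeral_2_eq_2 algebra_simps)
  have \<omega>: "0 \<le> \<omega>" using D [of 0 0] c by simp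
  \<comment> \<open>The two brackets are the double integrals over the square of side
    \<open>c\<close> evaluated through \<open>G\<close>; the factor 1/4 comes from the substitution
    \<open>2 * (s + t)\<close>.\<close>
  define S where "S x = (2 * (G (x + 2 * c) - 2 * G (x + c) + G x)
      - (G (x + 4 * c) - 2 * G (x + 2 * c) + G x) / 4) / c\<^sup>2" for x
  define S' where "S' x = (2 * (F (x + 2 * c) - 2 * F (x + c) + F x)
      - (F (x + 4 * c) - 2 * F (x + 2 * c) + F x) / 4) / c\<^sup>2" for x
  have S: "(S has_real_derivative S' x) (at x)" for x
    unfolding S_def [abs_def] S'_def
    by (rule DERIV_cdivide) (auto intro!: derivative_eq_intros G' simp: field_simps)
  have S': "(S' has_real_derivative (2 * D c x - D (2 * c) x / 4) / c\<^sup>2) (at x)" for x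
    unfolding S'_def [abs_def] D_def
    by (rule DERIV_cdivide) (auto intro!: derivative_eq_intros F' simp: field_simps)
  have near: "\<bar>g x - S x\<bar> \<le> \<omega>" if x: "0 \<le> x" for x
  proof -
    \<comment> \<open>\<open>A s\<close> is the integral of \<open>D (s + t) x\<close> over
      \<open>t\<close> from 0 to \<open>c\<close>. Two mean value estimates, first in
      \<open>t\<close> and then in \<open>s\<close>, replace the bound on the double integral of
      \<open>D (s + t) x\<close>, which equals \<open>c^2 * (g x - S x)\<close>.\<close>
    define A where "A s = (F (x + 2 * s + 2 * c) - F (x + 2 * s)) / 2
        - 2 * (F (x + s + c) - F (x + s)) + c * g x" for s
    have A: "\<bar>A s\<bar> \<le> \<omega> * c" if s: "0 \<le> s" "s \<le> c" for s
    proof -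
      let ?a = "\<lambda>t. F (x + 2 * s + 2 * t) / 2 - 2 * F (x + s + t) + t * g x"
      have "norm (?a c - ?a 0) \<le> \<omega> * norm (c - 0)"
      proof (rule field_differentiable_bound)
        fix t assume t: "t \<in> {0..c}"
        show "(?a has_real_derivative D (s + t) x) (at t within {0..c})"
          unfolding D_def
          by (rule has_field_derivative_at_within)
             (auto intro!: derivative_eq_intros F' simp: algebra_simps)
        show "norm (D (s + t) x) \<le> \<omega>" using D [of "s + t" x] s t x by simp
      qed (use c in auto)
      then show ?thesis using c by (simp add: A_def field_simps)
    qed
    let ?b = "\<lambda>s. (G (x + 2 * s + 2 * c) - G (x + 2 * s)) / 4
        - 2 * (G (x + s + c) - G (x + s)) + s * (c * g x)"
    have "norm (?b c - ?b 0) \<le> \<omega> * c * norm (c - 0)"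
    proof (rule field_differentiable_bound)
      fix s assume s: "s \<in> {0..c}"
      show "(?b has_real_derivative A s) (at s within {0..c})"
        unfolding A_def
        by (rule has_field_derivative_at_within)
           (auto intro!: derivative_eq_intros G' simp: field_simps)
      show "norm (A s) \<le> \<omega> * c" using A [of s] s by simp
    qed (use c in auto)
    moreover have "?b c - ?b 0 = c\<^sup>2 * (g x - S x)"
      using c by (simp add: S_def field_simps power2_eq_square)
    ultimately have "c\<^sup>2 * \<bar>g x - S x\<bar> \<le> c\<^sup>2 * \<omega>"
      using c by (simp add: abs_mult power2_eq_square mult_ac)
    then show ?thesis using c by simp
  qed
  \<comment> \<open>The second derivative of \<open>S\<close> is at most
    \<open>(2 + 1/4) * \<omega> / c^2\<close>, and \<open>c = \<delta> / 2\<close>.\<close>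
  define M where "M = 9 * \<omega> / \<delta>\<^sup>2"
  have M: "0 \<le> M" using \<omega> by (simp add: M_def)
  have S'': "\<bar>(2 * D c x - D (2 * c) x / 4) / c\<^sup>2\<bar> \<le> M" if "0 \<le> x" for x
  proof -
    have "\<bar>2 * D c x - D (2 * c) x / 4\<bar> \<le> 9 / 4 * \<omega>"
      using D [of c x] D [of "2 * c" x] c that by linarith
    then have "\<bar>2 * D c x - D (2 * c) x / 4\<bar> / c\<^sup>2 \<le> 9 / 4 * \<omega> / c\<^sup>2"
      by (rule divide_right_mono) simp
    also have "9 / 4 * \<omega> / c\<^sup>2 = M"
      by (simp add: M_def c_def power_divide)
    finally show ?thesis
      by (simp only: abs_divide abs_power2)
  qed
  \<comment> \<open>Two applications of the mean value inequality; the constant is \<open>M\<close>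
    instead of the \<open>M / 2\<close> of Taylor's formula.\<close>
  have taylor: "\<bar>S t - S y - S' y * (t - y)\<bar> \<le> M * (t - y)\<^sup>2" if t: "0 \<le> t" for t
  proof -
    have bound: "\<bar>S' u - S' y\<bar> \<le> M * \<bar>t - y\<bar>" if u: "u \<in> closed_segment y t" for u
    proof -
      have "0 \<le> u" "\<bar>u - y\<bar> \<le> \<bar>t - y\<bar>"
        using u t y by (auto simp: closed_segment_eq_real_ivl split: if_splits)
      moreover have "norm (S' u - S' y) \<le> M * norm (u - y)"
      proof (rule field_differentiable_bound [where S = "{0..}"])
        fix v :: real assume v: "v \<in> {0..}"
        show "(S' has_real_derivative (2 * D c v - D (2 * c) v / 4) / c\<^sup>2) (at v within {0..})"
          by (rule has_field_derivative_at_within [OF S'])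
        show "norm ((2 * D c v - D (2 * c) v / 4) / c\<^sup>2) \<le> M"
          using S'' [of v] v by simp
      qed (use y \<open>0 \<le> u\<close> in auto)
      ultimately show ?thesis
        using mult_left_mono [OF _ M, of "\<bar>u - y\<bar>" "\<bar>t - y\<bar>"] by simp
    qed
    have "norm ((S t - S' y * t) - (S y - S' y * y)) \<le> M * \<bar>t - y\<bar> * norm (t - y)"
    proof (rule field_differentiable_bound [where S = "closed_segment y t"])
      fix u assume u: "u \<in> closed_segment y t"
      show "((\<lambda>u. S u - S' y * u) has_real_derivative S' u - S' y) (at u within closed_segment y t)"
        by (rule has_field_derivative_at_within) (auto intro!: derivative_eq_intros S)
      show "norm (S' u - S' y) \<le> M * \<bar>t - y\<bar>" using bound [OF u] by simp
    qed auto
    also have "M * \<bar>t - y\<bar> * norm (t - y) = M * (t - y)\<^sup>2"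
      by (simp add: power2_eq_square)
    finally show ?thesis by (simp add: algebra_simps)
  qed
  show ?thesis
  proof (rule that)
    fix t :: real assume t: "0 \<le> t"
    have "\<bar>f t - f y - S' y * (t - y)\<bar> \<le> 2 * \<omega> + M * (t - y)\<^sup>2"
      using near [OF t] near [OF y] taylor [OF t] g_eq [OF t] g_eq [OF y] by linarith
    then show "\<bar>f t - f y - S' y * (t - y)\<bar> \<le> (2 + 9 * (t - y)\<^sup>2 / \<delta>\<^sup>2) * modulus 2 f \<delta>"
      by (simp add: M_def \<omega>_def algebra_simps)
  qed
qed

subsection \<open>The operators\<close>

text \<open>The sum of \<open>e i\<close> is the operator applied to the \<open>i\<close>-th power
  at \<open>x\<close>. The moment bounds for each \<open>k\<close> are averaged over the weights at
  \<open>z = n * x\<close>.\<close>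

lemma jain_durrmeyer_moments:
  fixes n :: nat and \<beta> x :: real
  assumes n: "n > 0" and \<beta>: "0 < \<beta>" "\<beta> < 1" and x: "0 \<le> x"
  defines "e i k \<equiv> jain_basis n \<beta> k x * (jain_moment n \<beta> k i / jain_moment n \<beta> k 0)"
  shows "summable (e 1)" and "summable (e 2)"
    and "x \<le> suminf (e 1)" and "suminf (e 1) \<le> x + 1 / (real n * (1 - \<beta>))"
    and "suminf (e 2) - (suminf (e 1))\<^sup>2
      \<le> 2 * (2 * x / (real n * (1 - \<beta>)) + 2 / ((real n)\<^sup>2 * (1 - \<beta>)) + 1 / ((real n)\<^sup>2 * (1 - \<beta>)\<^sup>2))"
proof -
  define b where "b = 1 - \<beta>"
  define z where "z = real n * x"
  define w where "w k = gpois \<beta> k z" for k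
  have b: "0 < b" using \<beta> by (simp add: b_def)
  have z: "0 \<le> z" using x by (simp add: z_def)
  have n': "0 < real n" using n by simp
  have \<beta>': "0 \<le> \<beta>" using \<beta> by simp
  have w: "0 \<le> w k" "jain_basis n \<beta> k x = w k" for k
    using gpois_nonneg [OF \<beta>' z] by (simp_all only: w_def z_def jain_basis_eq_gpois)
  note M = jain_moment_bounds [OF n \<beta>, folded b_def]
  have w0: "w sums 1" unfolding w_def [abs_def] by (rule gpois_sums_1 [OF \<beta>' \<beta>(2) z])
  have w1: "(\<lambda>k. real k * w k) sums (z / b)"
    unfolding w_def b_def by (rule gpois_first_moment [OF \<beta>' \<beta>(2) z])
  have w2: "summable (\<lambda>k. (real k)\<^sup>2 * w k)"
    unfolding w_def by (rule summable_gpois_second_moment [OF \<beta>' \<beta>(2) z])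
  have w2_le: "(\<Sum>k. (real k)\<^sup>2 * w k) \<le> z\<^sup>2 / b\<^sup>2 + z / b ^ 3"
    unfolding w_def b_def by (rule gpois_second_moment [OF \<beta>' \<beta>(2) z])

  have e1: "w k * (real k * b + 1) \<le> real n * e 1 k" "real n * e 1 k \<le> w k * (real k * b + 1 / b)" for k
  proof -
    have "real k * b + 1 \<le> real n * (jain_moment n \<beta> k 1 / jain_moment n \<beta> k 0)"
      "real n * (jain_moment n \<beta> k 1 / jain_moment n \<beta> k 0) \<le> real k * b + 1 / b"
      using M [of k] by (simp_all add: pos_le_divide_eq pos_divide_le_eq)
    then show "w k * (real k * b + 1) \<le> real n * e 1 k"
      "real n * e 1 k \<le> w k * (real k * b + 1 / b)"
      using mult_left_mono w(1) [of k] unfolding e_def w(2) by (metis mult.left_commute)+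
  qed
  have e2: "(real n)\<^sup>2 * e 2 k \<le> w k * ((real k)\<^sup>2 * b\<^sup>2 + 3 * real k + 2 / b)" for k
  proof -
    have "(real n)\<^sup>2 * (jain_moment n \<beta> k 2 / jain_moment n \<beta> k 0) \<le> (real k)\<^sup>2 * b\<^sup>2 + 3 * real k + 2 / b"
      using M [of k] by (simp add: pos_divide_le_eq)
    then show ?thesis
      using mult_left_mono w(1) [of k] unfolding e_def w(2) by (metis mult.left_commute)
  qed
  have e_nonneg: "0 \<le> e i k" for i k
  proof -
    have "0 \<le> jain_moment n \<beta> k i"
      unfolding jain_moment_def set_lebesgue_integral_def
      by (intro integral_nonneg_AE AE_I2)
         (auto simp: indicator_def jain_basis_eq_gpois \<beta>' intro!: gpois_nonneg mult_nonneg_nonneg)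
    then show ?thesis using M(1) [of k] w(1) [of k] by (simp add: e_def w(2))
  qed
  \<comment> \<open>The factor \<open>b\<close> cancels the mean \<open>z / b\<close> of the index,
    so both bounds on \<open>n\<close> times the mean are \<open>z\<close> plus a constant.\<close>
  have lower1: "(\<lambda>k. w k * (real k * b + 1)) sums (z + 1)"
    using sums_add [OF sums_mult [OF w1, of b] w0] b by (simp add: algebra_simps)
  have upper1: "(\<lambda>k. w k * (real k * b + 1 / b)) sums (z + 1 / b)"
    using sums_add [OF sums_mult [OF w1, of b] sums_mult [OF w0, of "1 / b"]] b
    by (simp add: algebra_simps)
  have upper2: "(\<lambda>k. w k * ((real k)\<^sup>2 * b\<^sup>2 + 3 * real k + 2 / b)) sums
      (b\<^sup>2 * (\<Sum>k. (real k)\<^sup>2 * w k) + 3 * (z / b) + 2 / b * 1)"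
    using sums_add [OF sums_add [OF sums_mult [OF summable_sums [OF w2], of "b\<^sup>2"]
        sums_mult [OF w1, of 3]] sums_mult [OF w0, of "2 / b"]]
    by (simp add: algebra_simps)

  have "summable (\<lambda>k. real n * e 1 k)"
    using e1 e_nonneg by (intro summable_comparison_test' [OF sums_summable [OF upper1]]) simp
  then show s1: "summable (e 1)" using n' by (simp add: summable_cmult_iff)
  have "summable (\<lambda>k. (real n)\<^sup>2 * e 2 k)"
    using e2 e_nonneg by (intro summable_comparison_test' [OF sums_summable [OF upper2]]) simp
  then show s2: "summable (e 2)" using n' by (simp add: summable_cmult_iff)
  note ns1 = sums_mult [OF summable_sums [OF s1], of "real n"]
  note ns2 = sums_mult [OF summable_sums [OF s2], of "(real n)\<^sup>2"]
  have y1: "z + 1 \<le> real n * suminf (e 1)" using sums_le [OF e1(1) lower1 ns1] .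
  have y2: "real n * suminf (e 1) \<le> z + 1 / b" using sums_le [OF e1(2) ns1 upper1] .
  have "real n * x \<le> real n * suminf (e 1)" using y1 by (simp add: z_def)
  then show "x \<le> suminf (e 1)" using n' by (rule mult_left_le_imp_le)
  have "real n * (x + 1 / (real n * b)) = z + 1 / b"
    using n' by (simp add: z_def distrib_left)
  then have "real n * suminf (e 1) \<le> real n * (x + 1 / (real n * b))"
    using y2 by simp
  then show "suminf (e 1) \<le> x + 1 / (real n * (1 - \<beta>))"
    using n' unfolding b_def by (rule mult_left_le_imp_le)

  define y where "y = real n * suminf (e 1)"
  have "(real n)\<^sup>2 * suminf (e 2) \<le> b\<^sup>2 * (\<Sum>k. (real k)\<^sup>2 * w k) + 3 * (z / b) + 2 / b * 1"
    using sums_le [OF e2 ns2 upper2] .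
  also have "\<dots> \<le> b\<^sup>2 * (z\<^sup>2 / b\<^sup>2 + z / b ^ 3) + 3 * (z / b) + 2 / b * 1"
    using w2_le by (intro add_right_mono mult_left_mono) auto
  also have "\<dots> = z\<^sup>2 + 4 * z / b + 2 / b"
    using b by (simp add: field_simps power2_eq_square power3_eq_cube)
  finally have "(real n)\<^sup>2 * suminf (e 2) - y\<^sup>2 \<le> z\<^sup>2 + 4 * z / b + 2 / b - y\<^sup>2" by simp
  also have "\<dots> \<le> 4 * z / b + 2 / b"
    \<comment> \<open>Since \<open>y\<close> is at least \<open>z\<close>, the quadratic terms
      cancel and only terms linear in \<open>z\<close> remain.\<close>
    using power_mono [of z y 2] y1 z by (simp add: y_def)
  also have "\<dots> \<le> 2 * (2 * z / b + 2 / b + 1 / b\<^sup>2)"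
  proof -
    have "2 / b \<le> 4 / b + 2 / b\<^sup>2"
      using b by (intro add_increasing2 divide_right_mono) auto
    then show ?thesis by simp
  qed
  also have "\<dots> = (real n)\<^sup>2 * (2 * (2 * x / (real n * b) + 2 / ((real n)\<^sup>2 * b) + 1 / ((real n)\<^sup>2 * b\<^sup>2)))"
    using n' b by (simp add: z_def field_simps power2_eq_square)
  finally have "(real n)\<^sup>2 * (suminf (e 2) - (suminf (e 1))\<^sup>2) \<le> \<dots>"
    by (simp add: y_def power_mult_distrib algebra_simps)
  then have "suminf (e 2) - (suminf (e 1))\<^sup>2
      \<le> 2 * (2 * x / (real n * b) + 2 / ((real n)\<^sup>2 * b) + 1 / ((real n)\<^sup>2 * b\<^sup>2))"
    by (rule mult_left_le_imp_le) (simp add: n)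
  then show "suminf (e 2) - (suminf (e 1))\<^sup>2
      \<le> 2 * (2 * x / (real n * (1 - \<beta>)) + 2 / ((real n)\<^sup>2 * (1 - \<beta>)) + 1 / ((real n)\<^sup>2 * (1 - \<beta>)\<^sup>2))"
    by (simp add: b_def)
qed

section \<open>The approximation estimate\<close>

text \<open>Dividing the basis function by its mass gives a probability density; the pointwise
  inequality is integrated against it, and \<open>m 1\<close>, \<open>m 2\<close> are its
  moments.\<close>

lemma jain_integral_linear_approximation:
  fixes k :: nat
  assumes n: "n > 0" and \<beta>: "0 < \<beta>" "\<beta> < 1" and f: "f \<in> C_B"
    and le: "\<And>t. 0 \<le> t \<Longrightarrow> \<bar>f t - c - a * (t - y)\<bar> \<le> A + B * (t - y)\<^sup>2"
  defines "m i \<equiv> jain_moment n \<beta> k i / jain_moment n \<beta> k 0"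
  shows "\<bar>(LBINT t:{0..}. jain_basis n \<beta> k t * f t) / jain_moment n \<beta> k 0 - c - a * (m 1 - y)\<bar>
      \<le> A + B * (m 2 - 2 * y * m 1 + y\<^sup>2)"
proof -
  let ?L = "jain_basis n \<beta> k" and ?J = "jain_moment n \<beta> k"
  have J0: "0 < ?J 0" by (rule jain_moment_bounds(1) [OF n \<beta>])
  have L: "0 \<le> ?L t" if "0 \<le> t" for t
    using that \<beta> by (simp add: jain_basis_eq_gpois gpois_nonneg)
  have int: "set_integrable lborel {0..} (\<lambda>t. ?L t * t ^ i)" for i
    by (rule set_integrable_jain_basis_power [OF n])
  have int0: "set_integrable lborel {0..} ?L" using int [of 0] by simp
  obtain K where K: "\<And>t. 0 \<le> t \<Longrightarrow> \<bar>f t\<bar> \<le> K"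
    using f by (auto simp: C_B_def bounded_iff)
  have intf: "set_integrable lborel {0..} (\<lambda>t. ?L t * f t)"
  proof (rule set_integrable_bound [OF set_integrable_mult_right [OF int0, of K]])
    have "continuous_on {0..} (\<lambda>t. ?L t * f t)"
      using f unfolding jain_basis_eq_poly_exp C_B_def by (intro continuous_intros) auto
    then show "set_borel_measurable lborel {0..} (\<lambda>t. ?L t * f t)"
      using set_measurable_continuous_on [of "{0..}" "\<lambda>t. ?L t * f t"]
      by (simp add: set_borel_measurable_def)
    have "norm (?L t * f t) \<le> norm (K * ?L t)" if "0 \<le> t" for t
    proof -
      have "\<bar>f t\<bar> * ?L t \<le> \<bar>K\<bar> * ?L t"
        using K [OF that] L [OF that] by (intro mult_right_mono) auto
      then show ?thesis
        using L [OF that] by (simp add: abs_mult mult.commute)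
    qed
    then show "AE t in lborel. t \<in> {0..} \<longrightarrow> norm (?L t * f t) \<le> norm (K * ?L t)"
      by auto
  qed
  let ?R = "\<lambda>t. ?L t * (f t - c - a * (t - y))"
  let ?P = "\<lambda>t. ?L t * (A + B * (t - y)\<^sup>2)"
  \<comment> \<open>The powers 0 and 1 of \<open>t\<close> are kept explicit so that each term has
    the form used in \<open>jain_moment\<close>.\<close>
  have R: "?R = (\<lambda>t. ?L t * f t - (c - a * y) * (?L t * t ^ 0) - a * (?L t * t ^ 1))"
    by (auto simp: algebra_simps)
  have P: "?P = (\<lambda>t. (A + B * y\<^sup>2) * (?L t * t ^ 0) - 2 * B * y * (?L t * t ^ 1) + B * (?L t * t ^ 2))"
    by (auto simp: algebra_simps power2_eq_square)
  have int_R: "set_integrable lborel {0..} ?R" and int_P: "set_integrable lborel {0..} ?P"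
    unfolding R P
    by (intro set_integral_add(1) set_integral_diff(1) set_integrable_mult_right int intf)+
  have R_eq: "(LBINT t:{0..}. ?R t) = (LBINT t:{0..}. ?L t * f t) - (c - a * y) * ?J 0 - a * ?J 1"
    unfolding R jain_moment_def
    by (simp only: set_integral_add(2) set_integral_diff set_integrable_mult_right int intf
        set_integral_mult_right)
  have P_eq: "(LBINT t:{0..}. ?P t) = (A + B * y\<^sup>2) * ?J 0 - 2 * B * y * ?J 1 + B * ?J 2"
    unfolding P jain_moment_def
    by (simp only: set_integral_add(2) set_integral_diff set_integrable_mult_right int intf
        set_integral_mult_right)
  have le': "\<bar>?R t\<bar> \<le> ?P t" if "0 \<le> t" for t
    using mult_left_mono [OF le [OF that] L [OF that]] L [OF that] by (simp add: abs_mult)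
  have "\<bar>LBINT t:{0..}. ?R t\<bar> \<le> (LBINT t:{0..}. \<bar>?R t\<bar>)"
    using integral_abs_bound [of lborel "\<lambda>t. indicator {0..} t * ?R t"]
    by (simp add: set_lebesgue_integral_def abs_mult)
  also have "\<dots> \<le> (LBINT t:{0..}. ?P t)"
    using le' by (intro set_integral_mono set_integrable_abs int_R int_P) auto
  finally have "\<bar>(LBINT t:{0..}. ?L t * f t) - (c - a * y) * ?J 0 - a * ?J 1\<bar> / ?J 0
      \<le> ((A + B * y\<^sup>2) * ?J 0 - 2 * B * y * ?J 1 + B * ?J 2) / ?J 0"
    unfolding R_eq P_eq using J0 by (intro divide_right_mono) auto
  also have "\<bar>(LBINT t:{0..}. ?L t * f t) - (c - a * y) * ?J 0 - a * ?J 1\<bar> / ?J 0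
      = \<bar>((LBINT t:{0..}. ?L t * f t) - (c - a * y) * ?J 0 - a * ?J 1) / ?J 0\<bar>"
    using J0 by simp
  also have "((LBINT t:{0..}. ?L t * f t) - (c - a * y) * ?J 0 - a * ?J 1) / ?J 0
      = (LBINT t:{0..}. ?L t * f t) / ?J 0 - c - a * (m 1 - y)"
    using J0 by (simp add: m_def field_simps)
  also have "((A + B * y\<^sup>2) * ?J 0 - 2 * B * y * ?J 1 + B * ?J 2) / ?J 0
      = A + B * (m 2 - 2 * y * m 1 + y\<^sup>2)"
    using J0 by (simp add: m_def field_simps)
  finally show ?thesis .
qed

theorem theorem2:
  "\<exists>C::real. C > 0 \<and>
     (\<forall>f\<in>C_B. \<forall>\<beta>::real. \<forall>n::nat. \<forall>x::real.
        0 < \<beta> \<and> \<beta> < 1 \<and> n > 0 \<and> x \<ge> 0 \<longrightarrow>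
        \<bar>jain_durrmeyer n \<beta> f x - f x\<bar>
          \<le> C * modulus 2 f (sqrt (2 * x / (real n * (1 - \<beta>))
                                     + 2 / ((real n)\<^sup>2 * (1 - \<beta>))
                                     + 1 / ((real n)\<^sup>2 * (1 - \<beta>)\<^sup>2)))
            + modulus 1 f (1 / (real n * (1 - \<beta>))))"
\<comment> \<open>The constant is \<open>2 + 9 * 2\<close>: the linear approximation bound combined
  with a variance of at most \<open>2 * \<delta>^2\<close>.\<close>
proof (intro exI [of _ 20] conjI ballI allI impI)
  fix f :: "real \<Rightarrow> real" and \<beta> x :: real and n :: nat
  assume f: "f \<in> C_B" and "0 < \<beta> \<and> \<beta> < 1 \<and> n > 0 \<and> x \<ge> 0"
  then have \<beta>: "0 < \<beta>" "\<beta> < 1" and n: "n > 0" and x: "0 \<le> x" by auto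
  define V where "V = 2 * x / (real n * (1 - \<beta>)) + 2 / ((real n)\<^sup>2 * (1 - \<beta>)) + 1 / ((real n)\<^sup>2 * (1 - \<beta>)\<^sup>2)"
  define \<delta> where "\<delta> = sqrt V"
  define w where "w k = jain_basis n \<beta> k x" for k
  define m where "m i k = jain_moment n \<beta> k i / jain_moment n \<beta> k 0" for i k
  define I where "I k = (LBINT t:{0..}. jain_basis n \<beta> k t * f t) / jain_moment n \<beta> k 0" for k
  define y where "y = (\<Sum>k. w k * m 1 k)"
  define \<omega> where "\<omega> = modulus 2 f \<delta>"
  have V: "0 < V"
    unfolding V_def using \<beta> n x by (intro add_nonneg_pos) auto
  then have \<delta>: "0 < \<delta>" "\<delta>\<^sup>2 = V" by (auto simp: \<delta>_def)
  have \<omega>: "0 \<le> \<omega>"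
    using abs_forward_diff_le_modulus [OF f, of 0 \<delta> 0 2] \<delta> by (simp add: \<omega>_def)
  note moments = jain_durrmeyer_moments [OF n \<beta> x, folded w_def m_def, folded y_def V_def]
  have y: "x \<le> y" "y \<le> x + 1 / (real n * (1 - \<beta>))" "0 \<le> y"
    using moments(3,4) x by auto
  have w: "w sums 1" "\<And>k. 0 \<le> w k"
    using gpois_sums_1 [of \<beta> "real n * x"] gpois_nonneg [of \<beta> "real n * x"] \<beta> x
    by (auto simp: w_def [abs_def] jain_basis_eq_gpois)
  have w1: "(\<lambda>k. w k * m 1 k) sums y"
    using moments(1) by (simp add: y_def summable_sums)
  obtain a where a: "\<And>t. 0 \<le> t \<Longrightarrow>
      \<bar>f t - f y - a * (t - y)\<bar> \<le> (2 + 9 * (t - y)\<^sup>2 / \<delta>\<^sup>2) * modulus 2 f \<delta>"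
    using C_B_linear_approximation [OF f \<delta>(1) y(3)] by blast
  have "\<bar>f t - f y - a * (t - y)\<bar> \<le> 2 * \<omega> + 9 * \<omega> / V * (t - y)\<^sup>2" if "0 \<le> t" for t
    using a [OF that] by (simp add: \<omega>_def \<delta>(2) algebra_simps)
  note I = jain_integral_linear_approximation [OF n \<beta> f this, folded m_def I_def]
  \<comment> \<open>\<open>u k\<close> is the \<open>k\<close>-th term of the operator applied to
    the remainder of \<open>f\<close> after subtraction of its linear approximation at
    \<open>y\<close>.\<close>
  define u where "u k = w k * (I k - f y - a * (m 1 k - y))" for k
  define v where "v k = w k * (2 * \<omega> + 9 * \<omega> / V * (m 2 k - 2 * y * m 1 k + y\<^sup>2))" for k
  have uv: "norm (u k) \<le> v k" for k
    using mult_left_mono [OF I [of k] w(2) [of k]] w(2) [of k] by (simp add: u_def v_def abs_mult)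
  have v: "v sums (2 * \<omega> * 1 + 9 * \<omega> / V * ((\<Sum>k. w k * m 2 k) - 2 * y * y + y\<^sup>2 * 1))"
    using sums_add [OF sums_mult [OF w(1), of "2 * \<omega>"] sums_mult [OF sums_add [OF sums_diff
        [OF summable_sums [OF moments(2)] sums_mult [OF w1, of "2 * y"]] sums_mult [OF w(1), of "y\<^sup>2"]], of "9 * \<omega> / V"]]
    unfolding v_def by (simp add: algebra_simps)
  have u: "summable u"
    using uv by (intro summable_comparison_test' [OF sums_summable [OF v]]) auto
  have "\<bar>suminf u\<bar> \<le> suminf v"
    using norm_suminf_le [OF uv sums_summable [OF v]] by simp
  also have "\<dots> = 2 * \<omega> + 9 * \<omega> / V * ((\<Sum>k. w k * m 2 k) - y\<^sup>2)"
    unfolding sums_unique [OF v, symmetric] by (simp add: power2_eq_square)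
  also have "\<dots> \<le> 2 * \<omega> + 9 * \<omega> / V * (2 * V)"
    using moments(5) \<omega> V by (intro add_left_mono mult_left_mono) auto
  finally have "\<bar>suminf u\<bar> \<le> 20 * \<omega>" using V by simp
  \<comment> \<open>Adding the linear part back costs only \<open>f y\<close>: because
    \<open>y\<close> is the image of the identity, the coefficient of the unknown slope
    \<open>a\<close> is 0.\<close>
  moreover have "(\<lambda>k. u k + f y * w k + a * (w k * m 1 k - y * w k))
      sums (suminf u + f y * 1 + a * (y - y * 1))"
    by (intro sums_add sums_mult sums_diff summable_sums [OF u] w w1)
  then have "(\<lambda>k. inverse (LBINT t:{0..}. jain_basis n \<beta> k t) * jain_basis n \<beta> k x
            * (LBINT t:{0..}. jain_basis n \<beta> k t * f t)) sums (suminf u + f y)"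
    by (simp add: u_def I_def w_def jain_moment_def algebra_simps divide_inverse)
  then have "jain_durrmeyer n \<beta> f x = suminf u + f y"
    by (simp add: jain_durrmeyer_def sums_iff)
  \<comment> \<open>The shift \<open>y - x\<close> is itself an admissible step, as it lies between
    0 and \<open>1 / (n * (1 - \<beta>))\<close>.\<close>
  moreover have "\<bar>f y - f x\<bar> \<le> modulus 1 f (1 / (real n * (1 - \<beta>)))"
    using abs_forward_diff_le_modulus [OF f, of "y - x" _ x 1] y x by (simp add: forward_diff_def)
  ultimately show "\<bar>jain_durrmeyer n \<beta> f x - f x\<bar>
      \<le> 20 * modulus 2 f (sqrt (2 * x / (real n * (1 - \<beta>)) + 2 / ((real n)\<^sup>2 * (1 - \<beta>))
          + 1 / ((real n)\<^sup>2 * (1 - \<beta>)\<^sup>2)))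
        + modulus 1 f (1 / (real n * (1 - \<beta>)))"
    unfolding V_def [symmetric] \<delta>_def [symmetric] \<omega>_def [symmetric] by linarith
qed simp

end
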